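(* Let $\mathbb K$ be a proper ordered field extension of $\mathbb R$ and let $\alpha,\beta\in\mathbb K$ be limited elements with $0<\beta\le\alpha$. Let $f_\alpha:(F,\delta,\Delta)\to(F_\alpha,\delta_\alpha,\Delta_\alpha)$ and $f_\beta:(F,\delta,\Delta)\to(F_\beta,\delta_\beta,\Delta_\beta)$ be two morphisms of galactic spaces (over $\mathbb K$) defined on the same galactic space, such that $f_\alpha$ is an $\alpha$-contraction and $f_\beta$ is a $\beta$-contraction. Then there is a unique map $f_{\beta,\alpha}:F_\alpha\to F_\beta$ such that $f_\beta=f_{\beta,\alpha}\circ f_\alpha$. Moreover, $f_{\beta,\alpha}$ is a $(\beta/\alpha)$-contraction $(F_\alpha,\delta_\alpha,\Delta_\alpha)\to(F_\beta,\delta_\beta,\Delta_\beta)$.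
   Context: A proper ordered field extension $\mathbb K$ of $\mathbb R$ is an ordered field with $\mathbb R\subsetneq\mathbb K$ whose ordered field structure restricts to the usual one on $\mathbb R$. An element $s\in\mathbb K$ is infinitely small ($s\simeq 0$) if $|s|<1/n$ for all integers $n\ge 1$, infinitely large if $|s|>n$ for all $n\in\mathbb N$ (written $s\simeq+\infty$ if $s>0$, $s\simeq-\infty$ if $s<0$), and limited if it is not infinitely large. $\mathrm{Hal}(0)$ is the additive subgroup of infinitely small elements, and $s\simeq t$ means $s-t\in \mathrm{Hal}(0)$. $\mathrm{Gal}(0)$ is the additive subgroup of limited elements; $\mathrm{Gal}(\mathbb K)=\mathbb K/\mathrm{Gal}(0)$, and $\mathrm{Gal}:\mathbb K\to\mathrm{Gal}(\mathbb K)$ is the canonical projection. $\mathrm{Gal}(\mathbb K)$ is a totally ordered additive group for: $\mathrm{Gal}(s)\le\mathrm{Gal}(t)$ iff $s\le t$ or $s-t\in\mathrm{Gal}(0)$. For each limited $s$ there is a unique real ${}^o s$ with $s\simeq{}^o s$; the principal value map $\mathrm{pv}:\mathbb K\to\mathbb R\cup\{\pm\infty\}$ sends limited $s$ to ${}^o s$ and $s\simeq\pm\infty$ to $\pm\infty$. For an ordered additive group $G$, $G_+=\{x\in G: x\ge 0\}$; the symbol $+\infty$ satisfies $x<+\infty$ and $x+(+\infty)=(+\infty)+x=+\infty$. A map $d$ on $X\times X$ with values in $G_+$ or $G_+\cup\{+\infty\}$ satisfies the general metric rule if for all $x,y,z\in X$: $d(x,x)=0$; $d(x,y)=d(y,x)>0$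 if $x\ne y$; $d(x,z)\le d(x,y)+d(y,z)$. A generalized distance on a set $F$ is a map $\delta:F\times F\to\mathbb R_+\cup\{+\infty\}$ satisfying the general metric rule. The metric components of $F$ for $\delta$ are the equivalence classes of the relation $\delta(x,y)<+\infty$; $\mathcal M_F$ is the set of metric components and $C_F(x)$ is the one containing $x$. A galactic distance on a set $\mathcal E$ is a map $\Delta:\mathcal E\times\mathcal E\to\mathrm{Gal}(\mathbb K)_+$ satisfying the general metric rule. A galactic space is a triple $(F,\delta,\Delta)$ with $F$ a set, $\delta$ a generalized distance on $F$ and $\Delta$ a galactic distance on $\mathcal M_F$. For limited $\gamma>0$ in $\mathbb K$ and $\tau=\mathrm{Gal}(t)\in\mathrm{Gal}(\mathbb K)$, put $\gamma.\tau=\{\gamma s: s\in\tau\}\subset\mathbb K$ and $\gamma\bullet\tau=\mathrm{Gal}(\gamma t)\in\mathrm{Gal}(\mathbb K)$. If $\tau>0$, $\mathrm{pv}$ is constant on $\gamma.\tau$ and its value is denoted $\mathrm{pv}(\gamma.\tau)$. A morphism $(F,\delta,\Delta)\to(F',\delta',\Delta')$ is a map $f:F\to F'$ for which there is a limited $\gamma>0$ in $\mathbb K$ with (1) $\delta'(f(x_1),f(x_2))\le\gamma\,\delta(x_1,x_2)$ for all $x_1,x_2\in F$ (with $a\le+\infty$ and $\gamma\cdot(+\infty)=+\infty$), so that for each $E\in\mathcal M_F$ the image $f(E)$ lies in a unique metric component of $F'$, denoted $f[E]=\widetilde f(E)$; and (2) $\Delta'(f[E_1],f[E_2])\le\gamma\bullet\Delta(E_1,E_2)$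 for all $E_1,E_2\in\mathcal M_F$. For limited $\gamma>0$ in $\mathbb K$, a $\gamma$-contraction of $(F,\delta,\Delta)$ is a morphism $f:(F,\delta,\Delta)\to(F',\delta',\Delta')$ that is surjective as a map $F\to F'$ and such that for all $x_1,x_2\in F$ and $E_1,E_2\in\mathcal M_F$: $\delta'(f(x_1),f(x_2))=\mathrm{pv}(\gamma\,\delta(x_1,x_2))$ if $\delta(x_1,x_2)<+\infty$; $\delta'(f(x_1),f(x_2))=\mathrm{pv}(\gamma.\Delta(C_F(x_1),C_F(x_2)))$ if $\delta(x_1,x_2)=+\infty$; and $\Delta'(f[E_1],f[E_2])=\gamma\bullet\Delta(E_1,E_2)$. *)

theory Defs
  imports Complex_Main "HOL-Library.Extended" "HOL-Library.Extended_Real" "HOL-Library.FuncSet"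
begin

no_notation Pinf (\<open>\<infinity>\<close>)
no_notation Minf (\<open>-\<infinity>\<close>)

section \<open>Ordered field extensions of the reals\<close>

text \<open>
  An ordered field extension of the reals is a type \<open>'k :: {linordered_field, real_field}\<close>,
  the embedding of the reals being \<open>of_real\<close>. The order of \<open>'k\<close> necessarily restricts to
  the usual one on the reals (next lemma). The extension is proper iff
  \<open>range (of_real :: real \<Rightarrow> 'k) \<noteq> UNIV\<close>.
\<close>

lemma of_real_le_iff_ext:
  "(of_real r :: 'k::{linordered_field, real_field}) \<le> of_real s \<longleftrightarrow> r \<le> s"
proof -
  have mono: "(of_real a :: 'k) \<le> of_real b" if "a \<le> b" for a b :: real
  proof -
    have "(of_real (b - a) :: 'k) = of_real (sqrt (b - a)) * of_real (sqrt (b - a))"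
      using that by (simp flip: of_real_mult)
    then have "(0 :: 'k) \<le> of_real (b - a)" by simp
    then show ?thesis by simp
  qed
  show ?thesis
  proof
    assume le: "(of_real r :: 'k) \<le> of_real s"
    show "r \<le> s"
    proof (rule ccontr)
      assume "\<not> r \<le> s"
      then have "(of_real s :: 'k) \<le> of_real r" by (intro mono) simp
      with le have "(of_real r :: 'k) = of_real s" by (rule order_antisym)
      then show False using \<open>\<not> r \<le> s\<close> by simp
    qed
  qed (rule mono)
qed

definition infinitely_small :: "'k::linordered_field \<Rightarrow> bool" where
  "infinitely_small s \<longleftrightarrow> (\<forall>n::nat. n \<ge> 1 \<longrightarrow> \<bar>s\<bar> < 1 / of_nat n)"

definition infinitely_large :: "'k::linordered_field \<Rightarrow> bool" where
  "infinitely_large s \<longleftrightarrow> (\<forall>n::nat. \<bar>s\<bar> > of_nat n)"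

definition limited :: "'k::linordered_field \<Rightarrow> bool" where
  "limited s \<longleftrightarrow> \<not> infinitely_large s"

definition standard_part :: "'k::{linordered_field, real_field} \<Rightarrow> real" where
  "standard_part s = (THE r. infinitely_small (s - of_real r))"

definition pv :: "'k::{linordered_field, real_field} \<Rightarrow> ereal" where
  "pv s = (if limited s then ereal (standard_part s) else if s > 0 then \<infinity> else - \<infinity>)"


section \<open>The ordered group of galaxies\<close>

lemma limited_iff: "limited s \<longleftrightarrow> (\<exists>n::nat. \<bar>s\<bar> \<le> of_nat n)"
  by (auto simp: limited_def infinitely_large_def not_less)

lemma limited_0 [simp]: "limited 0"
  by (auto simp: limited_iff)

lemma limited_minus: "limited s \<Longrightarrow> limited (- s)"
  by (auto simp: limited_iff)

lemma limited_add: "limited s \<Longrightarrow> limited t \<Longrightarrow> limited (s + t)"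
proof -
  assume "limited s" "limited t"
  then obtain m n :: nat where "\<bar>s\<bar> \<le> of_nat m" "\<bar>t\<bar> \<le> of_nat n"
    by (auto simp: limited_iff)
  then have "\<bar>s + t\<bar> \<le> of_nat (m + n)"
    by (auto intro: order_trans[OF abs_triangle_ineq add_mono])
  then show ?thesis unfolding limited_iff by blast
qed

lemma limited_diff: "limited s \<Longrightarrow> limited t \<Longrightarrow> limited (s - t)"
  using limited_add[of s "- t"] limited_minus[of t] by simp

lemma limited_mult: "limited s \<Longrightarrow> limited t \<Longrightarrow> limited (s * t)"
proof -
  assume "limited s" "limited t"
  then obtain m n :: nat where "\<bar>s\<bar> \<le> of_nat m" "\<bar>t\<bar> \<le> of_nat n"
    by (auto simp: limited_iff)
  then have "\<bar>s * t\<bar> \<le> of_nat (m * n)"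
    by (auto simp: abs_mult intro: mult_mono)
  then show ?thesis unfolding limited_iff by blast
qed

lemma limited_mono: "limited t \<Longrightarrow> \<bar>s\<bar> \<le> \<bar>t\<bar> \<Longrightarrow> limited s"
  unfolding limited_iff by (blast intro: order_trans)

lemma limited_commute: "limited (s - t) \<longleftrightarrow> limited (t - s)"
  using limited_minus[of "s - t"] limited_minus[of "t - s"] by auto

quotient_type (overloaded) 'k gal = "'k::linordered_field" / "\<lambda>s t. limited (s - t)"
proof (rule equivpI)
  show "reflp (\<lambda>s t::'k. limited (s - t))"
    by (simp add: reflp_def)
  show "symp (\<lambda>s t::'k. limited (s - t))"
    by (simp add: symp_def limited_commute)
  show "transp (\<lambda>s t::'k. limited (s - t))"
    unfolding transp_def
  proof (intro allI impI)
    fix s t u :: 'k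
    assume "limited (s - t)" "limited (t - u)"
    then have "limited ((s - t) + (t - u))" by (rule limited_add)
    then show "limited (s - u)" by simp
  qed
qed

lift_definition Gal :: "'k::linordered_field \<Rightarrow> 'k gal" is "\<lambda>s. s" .

lemma Gal_eq_iff: "Gal s = Gal t \<longleftrightarrow> limited (s - t)"
  by transfer simp

lemma le_or_near_iff: "s \<le> t \<or> limited (s - t) \<longleftrightarrow> (\<exists>u. limited u \<and> s \<le> t + u)"
proof
  assume "\<exists>u. limited u \<and> s \<le> t + u"
  then obtain u where u: "limited u" "s \<le> t + u" by blast
  show "s \<le> t \<or> limited (s - t)"
  proof (cases "s \<le> t")
    case False
    with u have "\<bar>s - t\<bar> \<le> \<bar>u\<bar>" by (auto simp: abs_if algebra_simps)
    with u show ?thesis using limited_mono by blast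
  qed simp
next
  assume "s \<le> t \<or> limited (s - t)"
  then show "\<exists>u. limited u \<and> s \<le> t + u"
  proof
    assume "s \<le> t"
    then show ?thesis by (intro exI[of _ 0]) simp
  next
    assume "limited (s - t)"
    then show ?thesis by (intro exI[of _ "s - t"]) simp
  qed
qed

instantiation gal :: (linordered_field) linordered_ab_group_add
begin

lift_definition zero_gal :: "'a gal" is 0 .

lift_definition plus_gal :: "'a gal \<Rightarrow> 'a gal \<Rightarrow> 'a gal" is "(+)"
proof -
  fix a b c d :: 'a
  assume "limited (a - b)" "limited (c - d)"
  then have "limited ((a - b) + (c - d))" by (rule limited_add)
  then show "limited (a + c - (b + d))" by (simp add: algebra_simps)
qed

lift_definition uminus_gal :: "'a gal \<Rightarrow> 'a gal" is uminus
  by (metis limited_minus minus_diff_minus)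

lift_definition minus_gal :: "'a gal \<Rightarrow> 'a gal \<Rightarrow> 'a gal" is "(-)"
proof -
  fix a b c d :: 'a
  assume "limited (a - b)" "limited (c - d)"
  then have "limited ((a - b) - (c - d))" by (rule limited_diff)
  then show "limited (a - c - (b - d))" by (simp add: algebra_simps)
qed

lift_definition less_eq_gal :: "'a gal \<Rightarrow> 'a gal \<Rightarrow> bool" is
  "\<lambda>s t. s \<le> t \<or> limited (s - t)"
proof -
  have *: "\<exists>u. limited u \<and> s' \<le> t' + u"
    if "limited (s - s')" "limited (t - t')" "\<exists>u. limited u \<and> s \<le> t + u" for s s' t t' :: 'a
  proof -
    from that(3) obtain u where u: "limited u" "s \<le> t + u" by blast
    have "limited (u + (t - t') - (s - s'))"
      by (rule limited_diff[OF limited_add[OF u(1) that(2)] that(1)])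
    moreover have "s' \<le> t' + (u + (t - t') - (s - s'))"
      using u by (simp add: algebra_simps)
    ultimately show ?thesis by blast
  qed
  show "(s \<le> t \<or> limited (s - t)) = (s' \<le> t' \<or> limited (s' - t'))"
    if "limited (s - s')" "limited (t - t')" for s s' t t' :: 'a
    unfolding le_or_near_iff
    using *[of s s' t t'] *[of s' s t' t] that
    by (simp only: limited_commute[of s' s] limited_commute[of t' t]) blast
qed

definition less_gal :: "'a gal \<Rightarrow> 'a gal \<Rightarrow> bool" where
  "less_gal x y \<longleftrightarrow> x \<le> y \<and> \<not> y \<le> x"

instance
proof
  fix x y z :: "'a gal"
  show "x + y + z = x + (y + z)" by transfer (simp add: algebra_simps)
  show "x + y = y + x" by transfer (simp add: algebra_simps)
  show "0 + x = x" by transfer simp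
  show "- x + x = 0" by transfer simp
  show "x - y = x + - y" by transfer simp
  show "x < y \<longleftrightarrow> x \<le> y \<and> \<not> y \<le> x" by (fact less_gal_def)
  show "x \<le> x" by transfer simp
  show "x \<le> z" if "x \<le> y" "y \<le> z"
    using that
  proof transfer
    fix a b c :: 'a
    assume "a \<le> b \<or> limited (a - b)" "b \<le> c \<or> limited (b - c)"
    then obtain u v where "limited u" "a \<le> b + u" "limited v" "b \<le> c + v"
      unfolding le_or_near_iff by blast
    then have "limited (u + v)" "a \<le> c + (u + v)"
      by (auto intro: limited_add)
    then show "a \<le> c \<or> limited (a - c)"
      unfolding le_or_near_iff by blast
  qed
  show "x = y" if "x \<le> y" "y \<le> x"
    using that
  proof transfer
    fix a b :: 'a
    assume "a \<le> b \<or> limited (a - b)" "b \<le> a \<or> limited (b - a)"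
    then show "limited (a - b)"
      using limited_commute[of a b] by (cases "a = b") auto
  qed
  show "x \<le> y \<or> y \<le> x" by transfer auto
  show "z + x \<le> z + y" if "x \<le> y" using that by transfer auto
qed

end

lemma Gal_le_iff: "Gal s \<le> Gal t \<longleftrightarrow> s \<le> t \<or> limited (s - t)"
  by transfer simp

lemma Gal_add: "Gal (s + t) = Gal s + Gal t"
  by transfer simp

text \<open>\<open>gal_times \<gamma> \<tau>\<close> is the subset \<open>\<gamma>.\<tau>\<close> of the field, and \<open>gal_scale \<gamma> \<tau>\<close> is the
  galaxy \<open>\<gamma> \<bullet> \<tau>\<close>; the latter is meaningful only for limited \<open>\<gamma>\<close>.\<close>

definition gal_times :: "'k::linordered_field \<Rightarrow> 'k gal \<Rightarrow> 'k set" where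
  "gal_times \<gamma> \<tau> = {\<gamma> * s |s. Gal s = \<tau>}"

definition gal_scale :: "'k::linordered_field \<Rightarrow> 'k gal \<Rightarrow> 'k gal" where
  "gal_scale \<gamma> \<tau> = the_elem (Gal ` gal_times \<gamma> \<tau>)"

lemma gal_scale_Gal:
  assumes "limited \<gamma>"
  shows "gal_scale \<gamma> (Gal t) = Gal (\<gamma> * t)"
proof -
  have eq: "Gal (\<gamma> * s) = Gal (\<gamma> * t)" if "Gal s = Gal t" for s
  proof -
    have "limited (\<gamma> * (s - t))"
      using assms that by (intro limited_mult) (simp_all add: Gal_eq_iff)
    then show ?thesis by (simp add: Gal_eq_iff right_diff_distrib)
  qed
  have "Gal ` gal_times \<gamma> (Gal t) = {Gal (\<gamma> * t)}"
  proof
    show "Gal ` gal_times \<gamma> (Gal t) \<subseteq> {Gal (\<gamma> * t)}"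
      unfolding gal_times_def using eq by blast
    show "{Gal (\<gamma> * t)} \<subseteq> Gal ` gal_times \<gamma> (Gal t)"
      unfolding gal_times_def by blast
  qed
  then show ?thesis by (simp add: gal_scale_def)
qed

definition pv_set :: "'k::{linordered_field, real_field} set \<Rightarrow> ereal" where
  "pv_set A = the_elem (pv ` A)"


section \<open>Galactic spaces\<close>

definition general_metric_rule ::
  "'x set \<Rightarrow> ('x \<Rightarrow> 'x \<Rightarrow> 'g::ordered_comm_monoid_add) \<Rightarrow> bool" where
  "general_metric_rule X d \<longleftrightarrow>
     (\<forall>x\<in>X. \<forall>y\<in>X. 0 \<le> d x y) \<and>
     (\<forall>x\<in>X. d x x = 0) \<and>
     (\<forall>x\<in>X. \<forall>y\<in>X. x \<noteq> y \<longrightarrow> d x y = d y x \<and> d x y > 0) \<and>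
     (\<forall>x\<in>X. \<forall>y\<in>X. \<forall>z\<in>X. d x z \<le> d x y + d y z)"

definition generalized_distance :: "'a set \<Rightarrow> ('a \<Rightarrow> 'a \<Rightarrow> ereal) \<Rightarrow> bool" where
  "generalized_distance F \<delta> \<longleftrightarrow> general_metric_rule F \<delta>"

definition galactic_distance ::
  "'e set \<Rightarrow> ('e \<Rightarrow> 'e \<Rightarrow> ('k::linordered_field) gal) \<Rightarrow> bool" where
  "galactic_distance \<E> \<Delta> \<longleftrightarrow> general_metric_rule \<E> \<Delta>"

definition metric_rel :: "'a set \<Rightarrow> ('a \<Rightarrow> 'a \<Rightarrow> ereal) \<Rightarrow> ('a \<times> 'a) set" where
  "metric_rel F \<delta> = {(x, y). x \<in> F \<and> y \<in> F \<and> \<delta> x y < \<infinity>}"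

definition metric_components :: "'a set \<Rightarrow> ('a \<Rightarrow> 'a \<Rightarrow> ereal) \<Rightarrow> 'a set set" where
  "metric_components F \<delta> = F // metric_rel F \<delta>"

definition metric_component :: "'a set \<Rightarrow> ('a \<Rightarrow> 'a \<Rightarrow> ereal) \<Rightarrow> 'a \<Rightarrow> 'a set" where
  "metric_component F \<delta> x = metric_rel F \<delta> `` {x}"

definition galactic_space ::
  "'a set \<Rightarrow> ('a \<Rightarrow> 'a \<Rightarrow> ereal) \<Rightarrow> ('a set \<Rightarrow> 'a set \<Rightarrow> ('k::linordered_field) gal) \<Rightarrow> bool"
  where
  "galactic_space F \<delta> \<Delta> \<longleftrightarrow>
     generalized_distance F \<delta> \<and> galactic_distance (metric_components F \<delta>) \<Delta>"

text \<open>The inequality \<open>\<delta>' \<le> \<gamma> \<delta>\<close> lives in the field extended by infinity, into which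
  \<open>ereal\<close> is embedded by \<open>to_ext\<close>.\<close>

fun to_ext :: "ereal \<Rightarrow> ('k::{linordered_field, real_field}) extended" where
  "to_ext (ereal r) = Fin (of_real r)"
| "to_ext PInfty = Pinf"
| "to_ext MInfty = Minf"

text \<open>For positive \<open>\<gamma>\<close> only.\<close>

fun ext_scale :: "'k::linordered_field \<Rightarrow> 'k extended \<Rightarrow> 'k extended" where
  "ext_scale \<gamma> (Fin s) = Fin (\<gamma> * s)"
| "ext_scale \<gamma> Pinf = Pinf"
| "ext_scale \<gamma> Minf = Minf"

definition induced ::
  "'b set \<Rightarrow> ('b \<Rightarrow> 'b \<Rightarrow> ereal) \<Rightarrow> ('a \<Rightarrow> 'b) \<Rightarrow> 'a set \<Rightarrow> 'b set" where
  "induced F' \<delta>' f E = (THE E'. E' \<in> metric_components F' \<delta>' \<and> f ` E \<subseteq> E')"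

definition galactic_morphism ::
  "'a set \<Rightarrow> ('a \<Rightarrow> 'a \<Rightarrow> ereal) \<Rightarrow> ('a set \<Rightarrow> 'a set \<Rightarrow> ('k::{linordered_field, real_field}) gal) \<Rightarrow>
   'b set \<Rightarrow> ('b \<Rightarrow> 'b \<Rightarrow> ereal) \<Rightarrow> ('b set \<Rightarrow> 'b set \<Rightarrow> 'k gal) \<Rightarrow> ('a \<Rightarrow> 'b) \<Rightarrow> bool" where
  "galactic_morphism F \<delta> \<Delta> F' \<delta>' \<Delta>' f \<longleftrightarrow>
     f \<in> F \<rightarrow> F' \<and>
     (\<exists>\<gamma>::'k. limited \<gamma> \<and> \<gamma> > 0 \<and>
        (\<forall>x\<in>F. \<forall>y\<in>F. (to_ext (\<delta>' (f x) (f y)) :: 'k extended) \<le> ext_scale \<gamma> (to_ext (\<delta> x y))) \<and>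
        (\<forall>E\<^sub>1 \<in> metric_components F \<delta>. \<forall>E\<^sub>2 \<in> metric_components F \<delta>.
           \<Delta>' (induced F' \<delta>' f E\<^sub>1) (induced F' \<delta>' f E\<^sub>2) \<le> gal_scale \<gamma> (\<Delta> E\<^sub>1 E\<^sub>2)))"

definition contraction ::
  "'k::{linordered_field, real_field} \<Rightarrow>
   'a set \<Rightarrow> ('a \<Rightarrow> 'a \<Rightarrow> ereal) \<Rightarrow> ('a set \<Rightarrow> 'a set \<Rightarrow> 'k gal) \<Rightarrow>
   'b set \<Rightarrow> ('b \<Rightarrow> 'b \<Rightarrow> ereal) \<Rightarrow> ('b set \<Rightarrow> 'b set \<Rightarrow> 'k gal) \<Rightarrow> ('a \<Rightarrow> 'b) \<Rightarrow> bool" where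
  "contraction \<gamma> F \<delta> \<Delta> F' \<delta>' \<Delta>' f \<longleftrightarrow>
     limited \<gamma> \<and> \<gamma> > 0 \<and>
     galactic_morphism F \<delta> \<Delta> F' \<delta>' \<Delta>' f \<and> f ` F = F' \<and>
     (\<forall>x\<in>F. \<forall>y\<in>F.
        (\<delta> x y < \<infinity> \<longrightarrow> \<delta>' (f x) (f y) = pv (\<gamma> * of_real (real_of_ereal (\<delta> x y)))) \<and>
        (\<delta> x y = \<infinity> \<longrightarrow> \<delta>' (f x) (f y) =
           pv_set (gal_times \<gamma> (\<Delta> (metric_component F \<delta> x) (metric_component F \<delta> y))))) \<and>
     (\<forall>E\<^sub>1 \<in> metric_components F \<delta>. \<forall>E\<^sub>2 \<in> metric_components F \<delta>.
        \<Delta>' (induced F' \<delta>' f E\<^sub>1) (induced F' \<delta>' f E\<^sub>2) = gal_scale \<gamma> (\<Delta> E\<^sub>1 E\<^sub>2))"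

end

(* Points of the source are compared through infinitesimals: whenever f_alpha has a finite value
   pv(alpha s), with s a distance or a representative of a positive galaxy, alpha s is infinitely
   close to it, and multiplying by the limited number beta/alpha gives beta s up to an
   infinitesimal, hence pv(beta s) = pv((beta/alpha) pv(alpha s)).  With value 0 this makes the
   factorization well defined; with a finite value it gives the distance formula. When the value is
   infinite, Gal(alpha s) is a positive galaxy and pv((beta/alpha).Gal(alpha s)) = pv(beta s). *)
theory Submission
  imports Defs
begin

section \<open>Infinitesimals and principal values\<close>

lemma of_real_less_iff_ext:
  "(of_real r :: 'k::{linordered_field, real_field}) < of_real s \<longleftrightarrow> r < s"
  by (metis of_real_le_iff_ext not_le)

lemma of_real_0_le_iff_ext:
  "(0 :: 'k::{linordered_field, real_field}) \<le> of_real s \<longleftrightarrow> 0 \<le> s"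
  using of_real_le_iff_ext[of 0 s, where 'k = 'k] by simp

lemma abs_of_real_ext:
  "\<bar>of_real r :: 'k::{linordered_field, real_field}\<bar> = of_real \<bar>r\<bar>"
proof (cases "0 \<le> r")
  case True
  then have "(0 :: 'k) \<le> of_real r" by (simp add: of_real_0_le_iff_ext)
  with True show ?thesis by simp
next
  case False
  then have "\<not> (0 :: 'k) \<le> of_real r" by (simp add: of_real_0_le_iff_ext)
  with False show ?thesis by simp
qed

lemma limited_of_real: "limited (of_real r :: 'k::{linordered_field, real_field})"
proof -
  obtain n :: nat where "\<bar>r\<bar> \<le> real n" using real_arch_simple by blast
  then have "(of_real \<bar>r\<bar> :: 'k) \<le> of_real (real n)" by (simp only: of_real_le_iff_ext)
  then show ?thesis unfolding limited_iff abs_of_real_ext by auto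
qed

text \<open>The bound is raised by one so that it is at least 1 and may appear in a
  denominator.\<close>

lemma limitedE:
  fixes s :: "'k::linordered_field"
  assumes "limited s"
  obtains n :: nat where "n \<ge> 1" "\<bar>s\<bar> \<le> of_nat n"
proof -
  obtain n :: nat where "\<bar>s\<bar> \<le> of_nat n" using assms by (auto simp: limited_iff)
  also have "(of_nat n :: 'k) \<le> of_nat (Suc n)" by simp
  finally show thesis by (intro that[of "Suc n"]) simp_all
qed

section \<open>Infinitely small elements as an ideal in the ring of limited ones\<close>

lemma infinitely_small_mono:
  "infinitely_small t \<Longrightarrow> \<bar>s\<bar> \<le> \<bar>t\<bar> \<Longrightarrow> infinitely_small s"
  unfolding infinitely_small_def by (meson le_less_trans)

lemma infinitely_small_minus: "infinitely_small s \<Longrightarrow> infinitely_small (- s)"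
  by (simp add: infinitely_small_def)

lemma infinitely_small_limited: "infinitely_small s \<Longrightarrow> limited s"
  unfolding infinitely_small_def limited_iff
  by (rule exI[of _ 1]) (use order_less_imp_le in fastforce)

lemma infinitely_small_mult:
  fixes s t :: "'k::linordered_field"
  assumes "limited s" "infinitely_small t"
  shows "infinitely_small (s * t)"
  unfolding infinitely_small_def
proof (intro allI impI)
  fix n :: nat
  assume n: "n \<ge> 1"
  obtain m :: nat where m: "m \<ge> 1" "\<bar>s\<bar> \<le> of_nat m" using assms(1) by (rule limitedE)
  \<comment> \<open>The factor \<open>s\<close>, bounded by \<open>m\<close>, is compensated by
    testing \<open>t\<close> at the finer level \<open>m * n\<close>.\<close>
  have mn: "m * n \<ge> 1" using m(1) n by simp
  have t: "\<bar>t\<bar> < 1 / of_nat (m * n)"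
    using assms(2) mn unfolding infinitely_small_def by blast
  have "\<bar>s * t\<bar> \<le> of_nat m * \<bar>t\<bar>"
    using m by (simp add: abs_mult mult_right_mono)
  also have "\<dots> < of_nat m * (1 / of_nat (m * n))"
    using t m(1) by (intro mult_strict_left_mono) auto
  also have "\<dots> = 1 / of_nat n" using m(1) by simp
  finally show "\<bar>s * t\<bar> < 1 / of_nat n" .
qed

lemma infinitely_small_add:
  fixes s t :: "'k::linordered_field"
  assumes "infinitely_small s" "infinitely_small t"
  shows "infinitely_small (s + t)"
  unfolding infinitely_small_def
proof (intro allI impI)
  fix n :: nat
  assume n: "n \<ge> 1"
  \<comment> \<open>Each summand gets half of the tolerance \<open>1 / n\<close>.\<close>
  then have "2 * n \<ge> 1" by simp
  then have "\<bar>s\<bar> < 1 / of_nat (2 * n)" "\<bar>t\<bar> < 1 / of_nat (2 * n)"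
    using assms unfolding infinitely_small_def by blast+
  then have "\<bar>s\<bar> + \<bar>t\<bar> < 1 / of_nat (2 * n) + 1 / of_nat (2 * n)"
    by (rule add_strict_mono)
  also have "\<dots> = 1 / of_nat n" using n by (simp add: field_simps)
  finally show "\<bar>s + t\<bar> < 1 / of_nat n" using abs_triangle_ineq le_less_trans by blast
qed

lemma infinitely_small_diff:
  "infinitely_small s \<Longrightarrow> infinitely_small t \<Longrightarrow> infinitely_small (s - t)"
  using infinitely_small_add[of s "- t"] by (simp add: infinitely_small_minus)

text \<open>The Archimedean property of the reals leaves no infinitely small real but 0; uniqueness
  of standard parts rests on this.\<close>

lemma infinitely_small_of_real:
  assumes "infinitely_small (of_real r :: 'k::{linordered_field, real_field})"
  shows "r = 0"
proof (rule ccontr)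
  assume "r \<noteq> 0"
  then obtain n :: nat where n: "n \<noteq> 0" "inverse (real n) < \<bar>r\<bar>"
    using real_arch_inverse[of "\<bar>r\<bar>"] by auto
  have "(of_real \<bar>r\<bar> :: 'k) < 1 / of_nat n"
    using assms n(1) by (simp add: infinitely_small_def abs_of_real_ext)
  also have "\<dots> = of_real (inverse (real n))" by (simp add: divide_inverse)
  finally show False using n(2) by (simp only: of_real_less_iff_ext)
qed

section \<open>Standard parts of limited elements\<close>

lemma infinitely_smallI:
  fixes s :: "'k::{linordered_field, real_field}"
  assumes "\<And>e. e > 0 \<Longrightarrow> \<bar>s\<bar> \<le> of_real e"
  shows "infinitely_small s"
  unfolding infinitely_small_def
proof (intro allI impI)
  fix n :: nat
  assume n: "n \<ge> 1"
  \<comment> \<open>Halving the tolerance turns the weak bound of the assumption into the strict one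
    of the definition.\<close>
  have "\<bar>s\<bar> \<le> of_real (1 / real (2 * n))" using n by (intro assms) simp
  also have "(of_real (1 / real (2 * n)) :: 'k) < of_real (1 / real n)"
    unfolding of_real_less_iff_ext using n by (simp add: field_simps)
  also have "\<dots> = 1 / of_nat n" by simp
  finally show "\<bar>s\<bar> < 1 / of_nat n" .
qed

text \<open>Completeness of the reals: the supremum of the reals below \<open>s\<close> is
  infinitely close to \<open>s\<close>. Limitedness makes this cut nonempty and bounded.\<close>

lemma limited_near_real:
  fixes s :: "'k::{linordered_field, real_field}"
  assumes "limited s"
  shows "\<exists>r. infinitely_small (s - of_real r)"
proof -
  obtain n :: nat where "\<bar>s\<bar> \<le> of_nat n" using assms by (auto simp: limited_iff)
  then have "\<bar>s\<bar> \<le> of_real (real n)" by simp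
  then have lo: "of_real (- real n) \<le> s" and hi: "s \<le> of_real (real n)"
    by (simp_all add: abs_le_iff)
  define A where "A = {r. of_real r \<le> s}"
  have ub: "r \<le> real n" if "r \<in> A" for r
  proof -
    have "(of_real r :: 'k) \<le> of_real (real n)"
      using that hi unfolding A_def mem_Collect_eq by (rule order_trans)
    then show ?thesis by (simp only: of_real_le_iff_ext)
  qed
  have bdd: "bdd_above A" using ub by (rule bdd_aboveI)
  have ne: "A \<noteq> {}" using lo unfolding A_def by blast
  have "infinitely_small (s - of_real (Sup A))"
  proof (rule infinitely_smallI)
    fix e :: real
    assume e: "e > 0"
    \<comment> \<open>The two halves of the estimate: \<open>Sup A + e\<close> lies outside the cut,
      while some element of the cut exceeds \<open>Sup A - e\<close>.\<close>
    have "Sup A + e \<notin> A"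
    proof
      assume "Sup A + e \<in> A"
      then have "Sup A + e \<le> Sup A" using bdd by (rule cSup_upper)
      with e show False by simp
    qed
    then have 1: "s \<le> of_real (Sup A) + of_real e" by (simp add: A_def)
    obtain a where a: "a \<in> A" "Sup A - e < a"
      using less_cSup_iff[OF ne bdd, of "Sup A - e"] e by auto
    have "(of_real (Sup A - e) :: 'k) < of_real a" using a by (simp only: of_real_less_iff_ext)
    also have "\<dots> \<le> s" using a by (simp add: A_def)
    finally have 2: "of_real (Sup A) - of_real e \<le> s" by simp
    show "\<bar>s - of_real (Sup A)\<bar> \<le> of_real e"
      unfolding abs_le_iff using 1 2 by (simp add: algebra_simps)
  qed
  then show ?thesis by blast
qed

text \<open>Two candidates differ by an infinitely small real, which is 0, so the \<open>THE\<close>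
  in the definition is determined.\<close>

lemma standard_part_eqI:
  fixes s :: "'k::{linordered_field, real_field}"
  assumes "infinitely_small (s - of_real r)"
  shows "standard_part s = r"
  unfolding standard_part_def
proof (rule the_equality)
  show "infinitely_small (s - of_real r)" by (fact assms)
  fix q
  assume "infinitely_small (s - of_real q)"
  with assms have "infinitely_small ((s - of_real r) - (s - of_real q))"
    by (rule infinitely_small_diff)
  then have "infinitely_small (of_real (q - r) :: 'k)" by simp
  then show "q = r" using infinitely_small_of_real by fastforce
qed

section \<open>Principal values and infinite closeness\<close>

lemma near_limited:
  fixes s t :: "'k::linordered_field"
  assumes "infinitely_small (s - t)" "limited t"
  shows "limited s"
  using limited_add[OF infinitely_small_limited[OF assms(1)] assms(2)] by simp

text \<open>Finite principal values become statements about infinitesimals, the form in which they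
  can be multiplied by limited factors.\<close>

lemma pv_eq_ereal_iff:
  fixes s :: "'k::{linordered_field, real_field}"
  shows "pv s = ereal r \<longleftrightarrow> infinitely_small (s - of_real r)"
proof
  assume near: "infinitely_small (s - of_real r)"
  then have "limited s" using limited_of_real by (rule near_limited)
  with near show "pv s = ereal r" by (simp add: pv_def standard_part_eqI)
next
  assume eq: "pv s = ereal r"
  then have lim: "limited s" by (auto simp: pv_def split: if_splits)
  then obtain q where q: "infinitely_small (s - of_real q)" using limited_near_real by blast
  then have "q = r" using eq lim by (simp add: pv_def standard_part_eqI)
  with q show "infinitely_small (s - of_real r)" by simp
qed

lemma pv_cong_near:
  fixes s t :: "'k::{linordered_field, real_field}"
  assumes near: "infinitely_small (s - t)"
  shows "pv s = pv t"
proof (cases "limited t")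
  case True
  then obtain r where r: "infinitely_small (t - of_real r)" using limited_near_real by blast
  then have "infinitely_small (s - of_real r)" using infinitely_small_add[OF near r] by simp
  with r have "pv s = ereal r" "pv t = ereal r" by (simp_all add: pv_eq_ereal_iff)
  then show ?thesis by simp
next
  case False
  have "\<not> limited s"
    using near_limited[of t s] infinitely_small_minus[OF near] False by auto
  moreover have "s > 0 \<longleftrightarrow> t > 0"
  proof -
    \<comment> \<open>In that case \<open>t\<close> would be bounded by an infinitely small element.
      So the perturbation is smaller than \<open>\<bar>t\<bar>\<close> and cannot change the
      sign.\<close>
    have "limited t" if "\<bar>t\<bar> \<le> \<bar>s - t\<bar>"
      using infinitely_small_limited[OF near] that by (rule limited_mono)
    with False have "\<bar>s - t\<bar> < \<bar>t\<bar>" by force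
    then show ?thesis by (auto simp: abs_if split: if_splits)
  qed
  ultimately show ?thesis using False by (simp add: pv_def)
qed

text \<open>The error \<open>\<gamma> * (s - of_real r)\<close> is limited times infinitely small.
  With \<beta>/\<alpha> as the factor, this passes from \<open>\<alpha> * s\<close> to
  \<open>\<beta> * s\<close>.\<close>

lemma pv_mult_near:
  fixes \<gamma> s :: "'k::{linordered_field, real_field}"
  assumes "limited \<gamma>" "pv s = ereal r"
  shows "pv (\<gamma> * s) = pv (\<gamma> * of_real r)"
proof (rule pv_cong_near)
  show "infinitely_small (\<gamma> * s - \<gamma> * of_real r)"
    using infinitely_small_mult[of \<gamma> "s - of_real r"] assms
    by (simp add: pv_eq_ereal_iff right_diff_distrib)
qed

lemma pv_eq_PInfty_iff:
  fixes s :: "'k::{linordered_field, real_field}"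
  shows "pv s = \<infinity> \<longleftrightarrow> s > 0 \<and> \<not> limited s"
  by (auto simp: pv_def)

lemma pv_nonneg_cases:
  fixes s :: "'k::{linordered_field, real_field}"
  assumes "s \<ge> 0"
  obtains r where "pv s = ereal r" | "pv s = \<infinity>"
  using assms by (cases "limited s") (auto simp: pv_def dest: order_le_imp_less_or_eq)

section \<open>Positive galaxies and the values they determine\<close>

lemma Gal_pos_iff: "0 < Gal s \<longleftrightarrow> 0 < s \<and> \<not> limited s"
proof -
  have z: "0 = Gal 0" by transfer simp
  have "0 < Gal s \<longleftrightarrow> \<not> Gal s \<le> Gal 0" unfolding z by (simp add: not_le)
  then show ?thesis by (auto simp: Gal_le_iff)
qed

lemma inverse_unlimited_infinitely_small:
  fixes s :: "'k::linordered_field"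
  assumes "\<not> limited s"
  shows "infinitely_small (1 / s)"
  unfolding infinitely_small_def
proof (intro allI impI)
  fix n :: nat
  assume n: "n \<ge> 1"
  have "of_nat n < \<bar>s\<bar>" using assms by (simp add: limited_def infinitely_large_def)
  then have "1 / \<bar>s\<bar> < 1 / of_nat n" using n
    by (intro divide_strict_left_mono mult_pos_pos) (auto intro: le_less_trans[of 0 "of_nat n"])
  then show "\<bar>1 / s\<bar> < 1 / of_nat n" by simp
qed

text \<open>Write \<gamma> as \<open>(\<gamma> * s) * (1 / s)\<close>, a limited factor times an
  infinitely small one.\<close>

lemma infinitely_small_if_mult_unlimited:
  fixes s \<gamma> :: "'k::linordered_field"
  assumes "limited (\<gamma> * s)" "\<not> limited s"
  shows "infinitely_small \<gamma>"
proof -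
  have "s \<noteq> 0" using assms(2) by auto
  then show ?thesis
    using infinitely_small_mult[OF assms(1) inverse_unlimited_infinitely_small[OF assms(2)]] by simp
qed

text \<open>Independence of the representative, in two cases. If \<gamma> is infinitely small, the
  limited difference of two representatives is scaled to an infinitesimal. Otherwise \<gamma> keeps
  positive infinitely large elements infinitely large, so the common value is
  \<open>\<infinity>\<close>.\<close>

lemma pv_set_gal_times:
  fixes \<gamma> t :: "'k::{linordered_field, real_field}"
  assumes "limited \<gamma>" "\<gamma> > 0" "0 < Gal t"
  shows "pv_set (gal_times \<gamma> (Gal t)) = pv (\<gamma> * t)"
proof -
  have const: "pv (\<gamma> * s) = pv (\<gamma> * t)" if eq: "Gal s = Gal t" for s
  proof (cases "infinitely_small \<gamma>")
    case True
    have "infinitely_small ((s - t) * \<gamma>)"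
      using True eq by (intro infinitely_small_mult) (simp_all add: Gal_eq_iff)
    then show ?thesis by (intro pv_cong_near) (simp add: algebra_simps)
  next
    case False
    have "pv (\<gamma> * u) = \<infinity>" if "0 < Gal u" for u
      using that assms(2) False infinitely_small_if_mult_unlimited[of \<gamma> u]
      unfolding pv_eq_PInfty_iff Gal_pos_iff by auto
    then show ?thesis using assms(3) eq by metis
  qed
  have "pv ` gal_times \<gamma> (Gal t) = {pv (\<gamma> * t)}"
    unfolding gal_times_def using const by blast
  then show ?thesis by (simp add: pv_set_def)
qed

lemma gal_exhaust:
  obtains t where "\<tau> = Gal t"
  by (transfer fixing: thesis) (metis diff_self limited_0)

section \<open>Metric components\<close>

lemma galactic_space_generalized_distance:
  "galactic_space F \<delta> \<Delta> \<Longrightarrow> generalized_distance F \<delta>"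
  by (simp add: galactic_space_def)

lemma generalized_distance_nonneg:
  "generalized_distance F \<delta> \<Longrightarrow> x \<in> F \<Longrightarrow> y \<in> F \<Longrightarrow> 0 \<le> \<delta> x y"
  by (simp add: generalized_distance_def general_metric_rule_def)

lemma generalized_distance_eq_0:
  "generalized_distance F \<delta> \<Longrightarrow> x \<in> F \<Longrightarrow> y \<in> F \<Longrightarrow> \<delta> x y = 0 \<longleftrightarrow> x = y"
  unfolding generalized_distance_def general_metric_rule_def by (metis less_irrefl)

lemma equiv_metric_rel:
  assumes "generalized_distance F \<delta>"
  shows "equiv F (metric_rel F \<delta>)"
proof (rule equivI)
  have rule: "general_metric_rule F \<delta>" using assms by (simp add: generalized_distance_def)
  show "metric_rel F \<delta> \<subseteq> F \<times> F" by (auto simp: metric_rel_def)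
  show "refl_on F (metric_rel F \<delta>)"
    using rule by (auto simp: refl_on_def metric_rel_def general_metric_rule_def)
  show "sym (metric_rel F \<delta>)"
    using rule unfolding sym_def metric_rel_def general_metric_rule_def by auto metis
  show "trans (metric_rel F \<delta>)"
  proof (rule transI)
    fix x y z
    assume "(x, y) \<in> metric_rel F \<delta>" "(y, z) \<in> metric_rel F \<delta>"
    then have in_F: "x \<in> F" "y \<in> F" "z \<in> F" and fin: "\<delta> x y < \<infinity>" "\<delta> y z < \<infinity>"
      by (auto simp: metric_rel_def)
    have "\<delta> x z \<le> \<delta> x y + \<delta> y z"
      using rule in_F by (auto simp: general_metric_rule_def)
    also have "\<dots> < \<infinity>" using fin by auto
    finally show "(x, z) \<in> metric_rel F \<delta>" using in_F by (simp add: metric_rel_def)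
  qed
qed

lemma metric_component_in: "x \<in> F \<Longrightarrow> metric_component F \<delta> x \<in> metric_components F \<delta>"
  by (simp add: metric_component_def metric_components_def quotientI)

lemma metric_componentsE:
  assumes "E \<in> metric_components F \<delta>"
  obtains x where "x \<in> F" "E = metric_component F \<delta> x"
  using assms unfolding metric_component_def metric_components_def by (rule quotientE)

lemma metric_component_eq_iff:
  assumes "generalized_distance F \<delta>" "x \<in> F" "y \<in> F"
  shows "metric_component F \<delta> x = metric_component F \<delta> y \<longleftrightarrow> \<delta> x y < \<infinity>"
  using eq_equiv_class_iff[OF equiv_metric_rel[OF assms(1)] assms(2,3)] assms(2,3)
  by (simp add: metric_component_def metric_rel_def)

text \<open>A component containing the image contains \<open>f x\<close>, and distinct components
  are disjoint, so the \<open>THE\<close> is resolved. The assumption is preservation of finite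
  distances, which makes the lemma applicable to a factor map before it is known to be a
  contraction.\<close>

lemma induced_metric_component:
  assumes F: "generalized_distance F \<delta>" and F': "generalized_distance F' \<delta>'"
    and f: "f \<in> F \<rightarrow> F'"
    and fin: "\<And>x y. x \<in> F \<Longrightarrow> y \<in> F \<Longrightarrow> \<delta> x y < \<infinity> \<Longrightarrow> \<delta>' (f x) (f y) < \<infinity>"
    and x: "x \<in> F"
  shows "induced F' \<delta>' f (metric_component F \<delta> x) = metric_component F' \<delta>' (f x)"
  unfolding induced_def
proof (rule the_equality)
  have fx: "f x \<in> F'" using f x by auto
  show "metric_component F' \<delta>' (f x) \<in> metric_components F' \<delta>' \<and>
    f ` metric_component F \<delta> x \<subseteq> metric_component F' \<delta>' (f x)"
    using fx f fin x by (auto simp: metric_component_in) (auto simp: metric_component_def metric_rel_def)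
  fix E'
  assume E': "E' \<in> metric_components F' \<delta>' \<and> f ` metric_component F \<delta> x \<subseteq> E'"
  have "x \<in> metric_component F \<delta> x"
    unfolding metric_component_def using equiv_class_self[OF equiv_metric_rel[OF F] x] .
  with E' have "f x \<in> E'" by auto
  moreover have "f x \<in> metric_component F' \<delta>' (f x)"
    unfolding metric_component_def using equiv_class_self[OF equiv_metric_rel[OF F'] fx] .
  ultimately show "E' = metric_component F' \<delta>' (f x)"
    using quotient_disj[OF equiv_metric_rel[OF F']] E' metric_component_in[OF fx]
    unfolding metric_components_def by blast
qed

lemma galactic_distance_nonneg:
  assumes "galactic_space F \<delta> \<Delta>" "E\<^sub>1 \<in> metric_components F \<delta>" "E\<^sub>2 \<in> metric_components F \<delta>"
  shows "0 \<le> \<Delta> E\<^sub>1 E\<^sub>2"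
  using assms by (simp add: galactic_space_def galactic_distance_def general_metric_rule_def)

text \<open>An infinite distance separates the components. The resulting positivity is what allows
  \<open>pv_set\<close> to be evaluated at a single representative.\<close>

lemma galactic_distance_component_pos:
  assumes "galactic_space F \<delta> \<Delta>" "x \<in> F" "y \<in> F" "\<delta> x y = \<infinity>"
  shows "0 < \<Delta> (metric_component F \<delta> x) (metric_component F \<delta> y)"
proof -
  have "metric_component F \<delta> x \<noteq> metric_component F \<delta> y"
    using assms metric_component_eq_iff[of F \<delta> x y] by (simp add: galactic_space_def)
  then show ?thesis
    using assms metric_component_in
    unfolding galactic_space_def galactic_distance_def general_metric_rule_def by metis
qed

section \<open>Comparison in the field extended by infinity\<close>

lemma to_ext_infinity: "to_ext \<infinity> = Pinf"
  unfolding infinity_ereal_def by (rule to_ext.simps)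

text \<open>The standard part \<open>c\<close> of \<gamma> can exceed \<gamma> but never
  \<open>2 * \<gamma>\<close>; this supplies the factor for the morphism condition.\<close>

lemma to_ext_pv_le:
  fixes \<gamma> :: "'k::{linordered_field, real_field}"
  assumes "limited \<gamma>" "\<gamma> > 0" "r \<ge> 0"
  shows "(to_ext (pv (\<gamma> * of_real r)) :: 'k extended) \<le> Fin (2 * \<gamma> * of_real r)"
proof -
  obtain c where c: "infinitely_small (\<gamma> - of_real c)" using limited_near_real[OF assms(1)] by blast
  have pv: "pv (\<gamma> * of_real r) = ereal (c * r)"
    using infinitely_small_mult[OF limited_of_real[of r] c]
    by (simp add: pv_eq_ereal_iff algebra_simps)
  have "of_real c \<le> 2 * \<gamma>"
  proof (rule ccontr)
    assume "\<not> of_real c \<le> 2 * \<gamma>"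
    then have c2: "2 * \<gamma> < of_real c" by simp
    \<comment> \<open>Here the rounding error \<open>of_real c - \<gamma>\<close> is larger than
      \<gamma>, which forces \<gamma>, and with it \<open>c\<close>, to be infinitely small.\<close>
    then have "\<bar>\<gamma>\<bar> \<le> \<bar>\<gamma> - of_real c\<bar>" using assms(2) by (simp add: abs_if)
    then have "infinitely_small \<gamma>" by (rule infinitely_small_mono[OF c])
    then have "infinitely_small (\<gamma> - (\<gamma> - of_real c))" using c by (rule infinitely_small_diff)
    then have "c = 0" by (intro infinitely_small_of_real) simp
    with c2 assms(2) show False by simp
  qed
  then have "of_real c * of_real r \<le> 2 * \<gamma> * of_real r"
    using assms(3) by (intro mult_right_mono) (simp_all add: of_real_0_le_iff_ext)
  with pv show ?thesis by simp
qed

section \<open>Contractions\<close>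

lemma contraction_scale:
  assumes "contraction \<gamma> F \<delta> \<Delta> F' \<delta>' \<Delta>' f"
  shows "limited \<gamma>" "\<gamma> > 0"
  using assms by (simp_all add: contraction_def)

lemma contraction_image:
  assumes "contraction \<gamma> F \<delta> \<Delta> F' \<delta>' \<Delta>' f"
  shows "f ` F = F'"
  using assms by (simp add: contraction_def)

lemma contraction_finite:
  assumes "contraction \<gamma> F \<delta> \<Delta> F' \<delta>' \<Delta>' f" "x \<in> F" "y \<in> F" "\<delta> x y < \<infinity>"
  shows "\<delta>' (f x) (f y) = pv (\<gamma> * of_real (real_of_ereal (\<delta> x y)))"
  using assms by (simp add: contraction_def)

lemma contraction_infinite:
  assumes "galactic_space F \<delta> \<Delta>" "contraction \<gamma> F \<delta> \<Delta> F' \<delta>' \<Delta>' f"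
    and "x \<in> F" "y \<in> F" "\<delta> x y = \<infinity>"
    and "\<Delta> (metric_component F \<delta> x) (metric_component F \<delta> y) = Gal t"
  shows "\<delta>' (f x) (f y) = pv (\<gamma> * t)"
  using assms pv_set_gal_times[of \<gamma> t] galactic_distance_component_pos[OF assms(1,3-5)]
  by (simp add: contraction_def)

text \<open>A limited factor times a real is limited, so its principal value is a real; hence
  components are carried into components.\<close>

lemma contraction_finite_imp_finite:
  assumes "contraction \<gamma> F \<delta> \<Delta> F' \<delta>' \<Delta>' f" "x \<in> F" "y \<in> F" "\<delta> x y < \<infinity>"
  shows "\<delta>' (f x) (f y) < \<infinity>"
  using contraction_finite[OF assms]
    limited_mult[OF contraction_scale(1)[OF assms(1)] limited_of_real[of "real_of_ereal (\<delta> x y)"]]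
  by (simp add: pv_def)

lemma contraction_induced_metric_component:
  assumes "galactic_space F \<delta> \<Delta>" "galactic_space F' \<delta>' \<Delta>'"
    and c: "contraction \<gamma> F \<delta> \<Delta> F' \<delta>' \<Delta>' f" and x: "x \<in> F"
  shows "induced F' \<delta>' f (metric_component F \<delta> x) = metric_component F' \<delta>' (f x)"
proof (rule induced_metric_component[OF _ _ _ _ x])
  show "f \<in> F \<rightarrow> F'" using contraction_image[OF c] by auto
qed (use assms contraction_finite_imp_finite[OF c] in \<open>auto simp: galactic_space_def\<close>)

text \<open>The galactic clause at the level of representatives, with image components named by
  points instead of by \<open>induced\<close>.\<close>

lemma contraction_galactic_distance:
  assumes "galactic_space F \<delta> \<Delta>" "galactic_space F' \<delta>' \<Delta>'"
    and c: "contraction \<gamma> F \<delta> \<Delta> F' \<delta>' \<Delta>' f" and "x \<in> F" "y \<in> F"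
    and "\<Delta> (metric_component F \<delta> x) (metric_component F \<delta> y) = Gal t"
  shows "\<Delta>' (metric_component F' \<delta>' (f x)) (metric_component F' \<delta>' (f y)) = Gal (\<gamma> * t)"
proof -
  have "\<Delta>' (induced F' \<delta>' f (metric_component F \<delta> x)) (induced F' \<delta>' f (metric_component F \<delta> y)) =
      gal_scale \<gamma> (\<Delta> (metric_component F \<delta> x) (metric_component F \<delta> y))"
    using c assms(4,5) by (simp add: contraction_def metric_component_in)
  then show ?thesis
    using assms(4-6) contraction_induced_metric_component[OF assms(1-3)]
    by (simp add: gal_scale_Gal[OF contraction_scale(1)[OF c]])
qed

text \<open>An element of the field standing for the real distance or, when that is infinite, for the
  galactic distance, so that both clauses of a \<open>\<gamma>\<close>-contraction take the form \<open>pv (\<gamma> * s)\<close>.\<close>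

definition separation ::
  "('a \<Rightarrow> 'a \<Rightarrow> ereal) \<Rightarrow> ('a set \<Rightarrow> 'a set \<Rightarrow> 'k::{linordered_field, real_field} gal) \<Rightarrow>
   'a set \<Rightarrow> 'a \<Rightarrow> 'a \<Rightarrow> 'k \<Rightarrow> bool" where
  "separation \<delta> \<Delta> F x y s \<longleftrightarrow> 0 \<le> s \<and>
     (if \<delta> x y = \<infinity> then \<Delta> (metric_component F \<delta> x) (metric_component F \<delta> y) = Gal s
      else s = of_real (real_of_ereal (\<delta> x y)))"

lemma separationE:
  assumes F: "galactic_space F \<delta> \<Delta>" and x: "x \<in> F" "y \<in> F"
  obtains s where "separation \<delta> \<Delta> F x y s" "s \<ge> 0"
proof (cases "\<delta> x y = \<infinity>")
  case True
  obtain t where t: "\<Delta> (metric_component F \<delta> x) (metric_component F \<delta> y) = Gal t"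
    by (rule gal_exhaust)
  \<comment> \<open>Positivity of the galaxy makes whichever representative was obtained
    positive.\<close>
  have "0 < Gal t" using galactic_distance_component_pos[OF F x True] t by simp
  then have "t \<ge> 0" by (simp add: Gal_pos_iff)
  with True t show thesis by (intro that) (simp_all add: separation_def)
next
  case False
  have "0 \<le> \<delta> x y"
    using galactic_space_generalized_distance[OF F] x by (rule generalized_distance_nonneg)
  with False show thesis
    by (intro that[of "of_real (real_of_ereal (\<delta> x y))"])
      (simp_all add: separation_def of_real_0_le_iff_ext real_of_ereal_pos)
qed

lemma contraction_separation:
  assumes "galactic_space F \<delta> \<Delta>" "contraction \<gamma> F \<delta> \<Delta> F' \<delta>' \<Delta>' f"
    and "x \<in> F" "y \<in> F" "separation \<delta> \<Delta> F x y s"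
  shows "\<delta>' (f x) (f y) = pv (\<gamma> * s)"
  using assms contraction_infinite[OF assms(1-4)] contraction_finite[OF assms(2-4)]
  by (cases "\<delta> x y = \<infinity>") (simp_all add: separation_def)

text \<open>Well-definedness of the factorization. Coincidence under \<open>f\<^sub>\<alpha>\<close>
  means that \<open>\<alpha> * s\<close> is infinitely small for a separation \<open>s\<close>; then
  so is \<open>\<beta> * s\<close>, which it dominates, and the distance in
  \<open>F\<^sub>\<beta>\<close> vanishes.\<close>

lemma contraction_kernel_mono:
  fixes \<alpha> \<beta> :: "'k::{linordered_field, real_field}"
  assumes "\<beta> \<le> \<alpha>"
    and F: "galactic_space F \<delta> \<Delta>"
    and F\<^sub>\<alpha>: "galactic_space F\<^sub>\<alpha> \<delta>\<^sub>\<alpha> \<Delta>\<^sub>\<alpha>" and F\<^sub>\<beta>: "galactic_space F\<^sub>\<beta> \<delta>\<^sub>\<beta> \<Delta>\<^sub>\<beta>"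
    and c\<^sub>\<alpha>: "contraction \<alpha> F \<delta> \<Delta> F\<^sub>\<alpha> \<delta>\<^sub>\<alpha> \<Delta>\<^sub>\<alpha> f\<^sub>\<alpha>"
    and c\<^sub>\<beta>: "contraction \<beta> F \<delta> \<Delta> F\<^sub>\<beta> \<delta>\<^sub>\<beta> \<Delta>\<^sub>\<beta> f\<^sub>\<beta>"
    and x: "x \<in> F" "y \<in> F" and eq: "f\<^sub>\<alpha> x = f\<^sub>\<alpha> y"
  shows "f\<^sub>\<beta> x = f\<^sub>\<beta> y"
proof -
  have in_F: "f\<^sub>\<alpha> x \<in> F\<^sub>\<alpha>" "f\<^sub>\<alpha> y \<in> F\<^sub>\<alpha>" "f\<^sub>\<beta> x \<in> F\<^sub>\<beta>" "f\<^sub>\<beta> y \<in> F\<^sub>\<beta>"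
    using contraction_image[OF c\<^sub>\<alpha>] contraction_image[OF c\<^sub>\<beta>] x by auto
  obtain s where sep: "separation \<delta> \<Delta> F x y s" "s \<ge> 0" using F x by (rule separationE)
  note s = sep(2) contraction_separation[OF F c\<^sub>\<alpha> x sep(1)] contraction_separation[OF F c\<^sub>\<beta> x sep(1)]
  have "\<delta>\<^sub>\<alpha> (f\<^sub>\<alpha> x) (f\<^sub>\<alpha> y) = 0"
    using generalized_distance_eq_0[OF galactic_space_generalized_distance[OF F\<^sub>\<alpha>] in_F(1,2)] eq
    by simp
  then have "infinitely_small (\<alpha> * s)"
    using s(2) pv_eq_ereal_iff[of "\<alpha> * s" 0] by (simp add: zero_ereal_def)
  moreover have "\<bar>\<beta> * s\<bar> \<le> \<bar>\<alpha> * s\<bar>"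
    using assms(1) s(1) contraction_scale[OF c\<^sub>\<alpha>] contraction_scale[OF c\<^sub>\<beta>]
    by (simp add: abs_mult mult_right_mono)
  ultimately have "infinitely_small (\<beta> * s)" by (rule infinitely_small_mono)
  then have "\<delta>\<^sub>\<beta> (f\<^sub>\<beta> x) (f\<^sub>\<beta> y) = 0"
    using s(3) pv_eq_ereal_iff[of "\<beta> * s" 0] by (simp add: zero_ereal_def)
  then show ?thesis
    using generalized_distance_eq_0[OF galactic_space_generalized_distance[OF F\<^sub>\<beta>] in_F(3,4)] by simp
qed

text \<open>Surjectivity of \<open>f\<^sub>\<alpha>\<close> lifts every condition on
  \<open>g\<close> to points of \<open>F\<close>, where both sides come from one field element,
  multiplied by \<alpha> and by \<beta>.\<close>

lemma contraction_quotient: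
  fixes \<alpha> \<beta> :: "'k::{linordered_field, real_field}"
  assumes le: "\<beta> \<le> \<alpha>"
    and F: "galactic_space F \<delta> \<Delta>"
    and F\<^sub>\<alpha>: "galactic_space F\<^sub>\<alpha> \<delta>\<^sub>\<alpha> \<Delta>\<^sub>\<alpha>" and F\<^sub>\<beta>: "galactic_space F\<^sub>\<beta> \<delta>\<^sub>\<beta> \<Delta>\<^sub>\<beta>"
    and c\<^sub>\<alpha>: "contraction \<alpha> F \<delta> \<Delta> F\<^sub>\<alpha> \<delta>\<^sub>\<alpha> \<Delta>\<^sub>\<alpha> f\<^sub>\<alpha>"
    and c\<^sub>\<beta>: "contraction \<beta> F \<delta> \<Delta> F\<^sub>\<beta> \<delta>\<^sub>\<beta> \<Delta>\<^sub>\<beta> f\<^sub>\<beta>"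
    and g: "\<And>x. x \<in> F \<Longrightarrow> f\<^sub>\<beta> x = g (f\<^sub>\<alpha> x)"
  shows "contraction (\<beta> / \<alpha>) F\<^sub>\<alpha> \<delta>\<^sub>\<alpha> \<Delta>\<^sub>\<alpha> F\<^sub>\<beta> \<delta>\<^sub>\<beta> \<Delta>\<^sub>\<beta> g"
proof -
  define \<gamma> where "\<gamma> = \<beta> / \<alpha>"
  have \<alpha>: "\<alpha> > 0" and \<beta>: "\<beta> > 0" using contraction_scale c\<^sub>\<alpha> c\<^sub>\<beta> by blast+
  have pos: "\<gamma> > 0" using \<alpha> \<beta> by (simp add: \<gamma>_def)
  \<comment> \<open>Limited elements may have an unlimited quotient; the bound 1 coming from
    \<open>\<beta> \<le> \<alpha>\<close> makes this one limited.\<close>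
  have "\<bar>\<gamma>\<bar> \<le> of_nat 1" using le \<alpha> \<beta> by (simp add: \<gamma>_def)
  then have lim: "limited \<gamma>" unfolding limited_iff by blast
  have \<gamma>\<alpha>: "\<gamma> * (\<alpha> * s) = \<beta> * s" for s using \<alpha> by (simp add: \<gamma>_def)
  have img\<^sub>\<alpha>: "f\<^sub>\<alpha> ` F = F\<^sub>\<alpha>" and img\<^sub>\<beta>: "f\<^sub>\<beta> ` F = F\<^sub>\<beta>"
    using contraction_image c\<^sub>\<alpha> c\<^sub>\<beta> by blast+
  have g_img: "g ` F\<^sub>\<alpha> = F\<^sub>\<beta>" using g unfolding img\<^sub>\<alpha>[symmetric] img\<^sub>\<beta>[symmetric] by force
  have fin: "\<delta>\<^sub>\<beta> (g u) (g v) = pv (\<gamma> * of_real (real_of_ereal (\<delta>\<^sub>\<alpha> u v)))"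
    if uv: "u \<in> F\<^sub>\<alpha>" "v \<in> F\<^sub>\<alpha>" "\<delta>\<^sub>\<alpha> u v < \<infinity>" for u v
  proof -
    obtain x y where xy: "x \<in> F" "y \<in> F" "u = f\<^sub>\<alpha> x" "v = f\<^sub>\<alpha> y" using uv img\<^sub>\<alpha> by blast
    \<comment> \<open>\<open>\<delta> x y\<close> may be infinite although
      \<open>\<delta>\<^sub>\<alpha> u v\<close> is finite; a separation covers both cases at
      once.\<close>
    obtain s where sep: "separation \<delta> \<Delta> F x y s" "s \<ge> 0"
      using F xy(1,2) by (rule separationE)
    have s: "\<delta>\<^sub>\<alpha> u v = pv (\<alpha> * s)" "\<delta>\<^sub>\<beta> (g u) (g v) = pv (\<beta> * s)"
      using contraction_separation[OF F c\<^sub>\<alpha> xy(1,2) sep(1)]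
        contraction_separation[OF F c\<^sub>\<beta> xy(1,2) sep(1)] g[OF xy(1)] g[OF xy(2)] xy(3,4)
      by simp_all
    have "\<alpha> * s \<ge> 0" using sep(2) \<alpha> by simp
    then obtain r where r: "pv (\<alpha> * s) = ereal r"
      using s(1) uv(3) by (cases rule: pv_nonneg_cases) auto
    show ?thesis using pv_mult_near[OF lim r] s r by (simp add: \<gamma>\<alpha>)
  qed
  have inf: "\<delta>\<^sub>\<beta> (g u) (g v) =
      pv_set (gal_times \<gamma> (\<Delta>\<^sub>\<alpha> (metric_component F\<^sub>\<alpha> \<delta>\<^sub>\<alpha> u) (metric_component F\<^sub>\<alpha> \<delta>\<^sub>\<alpha> v)))"
    if uv: "u \<in> F\<^sub>\<alpha>" "v \<in> F\<^sub>\<alpha>" "\<delta>\<^sub>\<alpha> u v = \<infinity>" for u v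
  proof -
    obtain x y where xy: "x \<in> F" "y \<in> F" "u = f\<^sub>\<alpha> x" "v = f\<^sub>\<alpha> y" using uv img\<^sub>\<alpha> by blast
    \<comment> \<open>An infinite distance in \<open>F\<^sub>\<alpha>\<close> can only come from an
      infinite one in \<open>F\<close>, so the value for \<open>f\<^sub>\<beta>\<close> is read off
      the galaxy.\<close>
    have "\<delta> x y = \<infinity>"
      using contraction_finite_imp_finite[OF c\<^sub>\<alpha> xy(1,2)] uv(3) xy by auto
    obtain s where s: "\<Delta> (metric_component F \<delta> x) (metric_component F \<delta> y) = Gal s"
      by (rule gal_exhaust)
    have \<delta>\<^sub>\<beta>: "\<delta>\<^sub>\<beta> (g u) (g v) = pv (\<beta> * s)"
      using contraction_infinite[OF F c\<^sub>\<beta> xy(1,2) \<open>\<delta> x y = \<infinity>\<close> s] g[OF xy(1)] g[OF xy(2)] xy(3,4)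
      by simp
    have \<Delta>: "\<Delta>\<^sub>\<alpha> (metric_component F\<^sub>\<alpha> \<delta>\<^sub>\<alpha> u) (metric_component F\<^sub>\<alpha> \<delta>\<^sub>\<alpha> v) = Gal (\<alpha> * s)"
      using contraction_galactic_distance[OF F F\<^sub>\<alpha> c\<^sub>\<alpha> xy(1,2) s] xy(3,4) by simp
    \<comment> \<open>The infinite distance in \<open>F\<^sub>\<alpha>\<close> gives the positive
      galaxy needed to evaluate \<open>pv_set\<close> at \<open>\<alpha> * s\<close>.\<close>
    have "0 < Gal (\<alpha> * s)" using galactic_distance_component_pos[OF F\<^sub>\<alpha> uv] \<Delta> by simp
    then have "pv_set (gal_times \<gamma> (Gal (\<alpha> * s))) = pv (\<gamma> * (\<alpha> * s))"
      by (rule pv_set_gal_times[OF lim pos])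
    then show ?thesis using \<delta>\<^sub>\<beta> \<Delta> by (simp add: \<gamma>\<alpha>)
  qed
  have fin_fin: "\<delta>\<^sub>\<beta> (g u) (g v) < \<infinity>" if "u \<in> F\<^sub>\<alpha>" "v \<in> F\<^sub>\<alpha>" "\<delta>\<^sub>\<alpha> u v < \<infinity>" for u v
    unfolding fin[OF that] using limited_mult[OF lim limited_of_real] by (simp add: pv_def)
  have ind: "induced F\<^sub>\<beta> \<delta>\<^sub>\<beta> g (metric_component F\<^sub>\<alpha> \<delta>\<^sub>\<alpha> u) = metric_component F\<^sub>\<beta> \<delta>\<^sub>\<beta> (g u)"
    if "u \<in> F\<^sub>\<alpha>" for u
    using g_img fin_fin that F\<^sub>\<alpha> F\<^sub>\<beta>
    by (intro induced_metric_component galactic_space_generalized_distance) auto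
  have gal: "\<Delta>\<^sub>\<beta> (induced F\<^sub>\<beta> \<delta>\<^sub>\<beta> g E\<^sub>1) (induced F\<^sub>\<beta> \<delta>\<^sub>\<beta> g E\<^sub>2) = gal_scale \<gamma> (\<Delta>\<^sub>\<alpha> E\<^sub>1 E\<^sub>2)"
    if E: "E\<^sub>1 \<in> metric_components F\<^sub>\<alpha> \<delta>\<^sub>\<alpha>" "E\<^sub>2 \<in> metric_components F\<^sub>\<alpha> \<delta>\<^sub>\<alpha>" for E\<^sub>1 E\<^sub>2
  proof -
    obtain u where u: "u \<in> F\<^sub>\<alpha>" "E\<^sub>1 = metric_component F\<^sub>\<alpha> \<delta>\<^sub>\<alpha> u"
      using E(1) by (rule metric_componentsE)
    obtain v where v: "v \<in> F\<^sub>\<alpha>" "E\<^sub>2 = metric_component F\<^sub>\<alpha> \<delta>\<^sub>\<alpha> v"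
      using E(2) by (rule metric_componentsE)
    obtain x y where xy: "x \<in> F" "y \<in> F" "u = f\<^sub>\<alpha> x" "v = f\<^sub>\<alpha> y" using u v img\<^sub>\<alpha> by blast
    obtain t where t: "\<Delta> (metric_component F \<delta> x) (metric_component F \<delta> y) = Gal t"
      by (rule gal_exhaust)
    have "\<Delta>\<^sub>\<alpha> E\<^sub>1 E\<^sub>2 = Gal (\<alpha> * t)"
      unfolding u(2) v(2) xy(3,4) by (rule contraction_galactic_distance[OF F F\<^sub>\<alpha> c\<^sub>\<alpha> xy(1,2) t])
    then have "gal_scale \<gamma> (\<Delta>\<^sub>\<alpha> E\<^sub>1 E\<^sub>2) = Gal (\<beta> * t)"
      by (simp only: gal_scale_Gal[OF lim] \<gamma>\<alpha>)
    moreover have "\<Delta>\<^sub>\<beta> (induced F\<^sub>\<beta> \<delta>\<^sub>\<beta> g E\<^sub>1) (induced F\<^sub>\<beta> \<delta>\<^sub>\<beta> g E\<^sub>2) = Gal (\<beta> * t)"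
      using contraction_galactic_distance[OF F F\<^sub>\<beta> c\<^sub>\<beta> xy(1,2) t]
      unfolding u(2) v(2) ind[OF u(1)] ind[OF v(1)]
      unfolding xy(3,4) g[OF xy(1)] g[OF xy(2)] .
    ultimately show ?thesis by simp
  qed
  have "galactic_morphism F\<^sub>\<alpha> \<delta>\<^sub>\<alpha> \<Delta>\<^sub>\<alpha> F\<^sub>\<beta> \<delta>\<^sub>\<beta> \<Delta>\<^sub>\<beta> g"
    unfolding galactic_morphism_def
  \<comment> \<open>The factor \<open>\<gamma>\<close> itself may fail, since taking the standard part can round up.\<close>
  proof (intro conjI exI[of _ "2 * \<gamma>"] ballI)
    show "g \<in> F\<^sub>\<alpha> \<rightarrow> F\<^sub>\<beta>" using g_img by auto
    have lim2: "limited (2 * \<gamma>)" using limited_add[OF lim lim] by (simp only: mult_2)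
    then show "limited (2 * \<gamma>)" .
    show "0 < 2 * \<gamma>" using pos by simp
    show "(to_ext (\<delta>\<^sub>\<beta> (g u) (g v)) :: 'k extended) \<le> ext_scale (2 * \<gamma>) (to_ext (\<delta>\<^sub>\<alpha> u v))"
      if uv: "u \<in> F\<^sub>\<alpha>" "v \<in> F\<^sub>\<alpha>" for u v
    proof (cases "\<delta>\<^sub>\<alpha> u v")
      case (real r)
      have "0 \<le> \<delta>\<^sub>\<alpha> u v"
        using galactic_space_generalized_distance[OF F\<^sub>\<alpha>] uv by (rule generalized_distance_nonneg)
      then show ?thesis using fin[OF uv] to_ext_pv_le[OF lim pos, of r] real by simp
    next
      case PInf
      then show ?thesis by (cases "to_ext (\<delta>\<^sub>\<beta> (g u) (g v)) :: 'k extended") (simp_all add: to_ext_infinity)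
    next
      case MInf
      then show ?thesis using generalized_distance_nonneg[OF galactic_space_generalized_distance[OF F\<^sub>\<alpha>] uv]
        by simp
    qed
    show "\<Delta>\<^sub>\<beta> (induced F\<^sub>\<beta> \<delta>\<^sub>\<beta> g E\<^sub>1) (induced F\<^sub>\<beta> \<delta>\<^sub>\<beta> g E\<^sub>2) \<le> gal_scale (2 * \<gamma>) (\<Delta>\<^sub>\<alpha> E\<^sub>1 E\<^sub>2)"
      if E: "E\<^sub>1 \<in> metric_components F\<^sub>\<alpha> \<delta>\<^sub>\<alpha>" "E\<^sub>2 \<in> metric_components F\<^sub>\<alpha> \<delta>\<^sub>\<alpha>" for E\<^sub>1 E\<^sub>2
    proof -
      obtain t where t: "\<Delta>\<^sub>\<alpha> E\<^sub>1 E\<^sub>2 = Gal t" by (rule gal_exhaust)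
      \<comment> \<open>Let \<open>x\<close> be this galaxy. It equals the one scaled by \<gamma>,
        and nonnegativity gives \<open>x \<le> x + x\<close>, which is the bound with factor
        \<open>2 * \<gamma>\<close>.\<close>
      have nonneg: "0 \<le> \<Delta>\<^sub>\<beta> (induced F\<^sub>\<beta> \<delta>\<^sub>\<beta> g E\<^sub>1) (induced F\<^sub>\<beta> \<delta>\<^sub>\<beta> g E\<^sub>2)"
      proof -
        have "induced F\<^sub>\<beta> \<delta>\<^sub>\<beta> g E \<in> metric_components F\<^sub>\<beta> \<delta>\<^sub>\<beta>"
          if E: "E \<in> metric_components F\<^sub>\<alpha> \<delta>\<^sub>\<alpha>" for E
          using E
        proof (rule metric_componentsE)
          fix u
          assume u: "u \<in> F\<^sub>\<alpha>" "E = metric_component F\<^sub>\<alpha> \<delta>\<^sub>\<alpha> u"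
          then have "g u \<in> F\<^sub>\<beta>" using g_img by blast
          then show ?thesis using u ind[OF u(1)] by (simp add: metric_component_in)
        qed
        then show ?thesis using E by (intro galactic_distance_nonneg[OF F\<^sub>\<beta>])
      qed
      have "Gal (2 * \<gamma> * t) = Gal (\<gamma> * t) + Gal (\<gamma> * t)"
        by (simp only: mult_2 distrib_right Gal_add)
      then show ?thesis using nonneg unfolding gal[OF E] t
        by (simp add: gal_scale_Gal[OF lim] gal_scale_Gal[OF lim2])
    qed
  qed
  then show ?thesis
    unfolding contraction_def \<gamma>_def[symmetric] by (simp add: lim pos g_img fin inf gal)
qed

text \<open>Functions of HOL are total, so uniqueness is stated among maps equal to
  \<open>undefined\<close> outside \<open>F\<^sub>\<alpha>\<close>, while the contraction property
  covers every factor map, whatever its values there.\<close>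

theorem proposition3:
  fixes \<alpha> \<beta> :: "'k::{linordered_field, real_field}"
    and F :: "'a set" and \<delta> :: "'a \<Rightarrow> 'a \<Rightarrow> ereal" and \<Delta> :: "'a set \<Rightarrow> 'a set \<Rightarrow> 'k gal"
    and F\<^sub>\<alpha> :: "'b set" and \<delta>\<^sub>\<alpha> :: "'b \<Rightarrow> 'b \<Rightarrow> ereal" and \<Delta>\<^sub>\<alpha> :: "'b set \<Rightarrow> 'b set \<Rightarrow> 'k gal"
    and F\<^sub>\<beta> :: "'c set" and \<delta>\<^sub>\<beta> :: "'c \<Rightarrow> 'c \<Rightarrow> ereal" and \<Delta>\<^sub>\<beta> :: "'c set \<Rightarrow> 'c set \<Rightarrow> 'k gal"
    and f\<^sub>\<alpha> :: "'a \<Rightarrow> 'b" and f\<^sub>\<beta> :: "'a \<Rightarrow> 'c"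
  assumes proper: "range (of_real :: real \<Rightarrow> 'k) \<noteq> UNIV"
    and "limited \<alpha>" and "limited \<beta>" and "0 < \<beta>" and "\<beta> \<le> \<alpha>"
    and "galactic_space F \<delta> \<Delta>"
    and "galactic_space F\<^sub>\<alpha> \<delta>\<^sub>\<alpha> \<Delta>\<^sub>\<alpha>"
    and "galactic_space F\<^sub>\<beta> \<delta>\<^sub>\<beta> \<Delta>\<^sub>\<beta>"
    and "contraction \<alpha> F \<delta> \<Delta> F\<^sub>\<alpha> \<delta>\<^sub>\<alpha> \<Delta>\<^sub>\<alpha> f\<^sub>\<alpha>"
    and "contraction \<beta> F \<delta> \<Delta> F\<^sub>\<beta> \<delta>\<^sub>\<beta> \<Delta>\<^sub>\<beta> f\<^sub>\<beta>"
  shows "(\<exists>!g. g \<in> F\<^sub>\<alpha> \<rightarrow>\<^sub>E F\<^sub>\<beta> \<and> (\<forall>x\<in>F. f\<^sub>\<beta> x = g (f\<^sub>\<alpha> x))) \<and>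
    (\<forall>g. g \<in> F\<^sub>\<alpha> \<rightarrow> F\<^sub>\<beta> \<and> (\<forall>x\<in>F. f\<^sub>\<beta> x = g (f\<^sub>\<alpha> x)) \<longrightarrow>
       contraction (\<beta> / \<alpha>) F\<^sub>\<alpha> \<delta>\<^sub>\<alpha> \<Delta>\<^sub>\<alpha> F\<^sub>\<beta> \<delta>\<^sub>\<beta> \<Delta>\<^sub>\<beta> g)"
proof (intro conjI allI impI)
  \<comment> \<open>An arbitrary preimage is chosen for each point; \<open>restrict\<close> fixes
    the value elsewhere to \<open>undefined\<close>, as \<open>\<rightarrow>\<^sub>E\<close>
    requires.\<close>
  define h where "h = restrict (\<lambda>u. f\<^sub>\<beta> (SOME x. x \<in> F \<and> f\<^sub>\<alpha> x = u)) F\<^sub>\<alpha>"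
  have img: "f\<^sub>\<alpha> ` F = F\<^sub>\<alpha>" "f\<^sub>\<beta> ` F = F\<^sub>\<beta>"
    using assms(9,10) by (simp_all add: contraction_image)
  have h: "f\<^sub>\<beta> x = h (f\<^sub>\<alpha> x)" if x: "x \<in> F" for x
  proof -
    define y where "y = (SOME y. y \<in> F \<and> f\<^sub>\<alpha> y = f\<^sub>\<alpha> x)"
    have y: "y \<in> F \<and> f\<^sub>\<alpha> y = f\<^sub>\<alpha> x"
      unfolding y_def by (rule someI[of _ x]) (use x in simp)
    have "f\<^sub>\<alpha> x \<in> F\<^sub>\<alpha>" using img x by blast
    then have "h (f\<^sub>\<alpha> x) = f\<^sub>\<beta> y" by (simp add: h_def y_def)
    \<comment> \<open>The chosen preimage need not be \<open>x\<close>, but both have the same image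
      under \<open>f\<^sub>\<alpha>\<close>, hence under \<open>f\<^sub>\<beta>\<close>.\<close>
    moreover have "f\<^sub>\<beta> y = f\<^sub>\<beta> x"
      using contraction_kernel_mono[OF assms(5-10)] x y by blast
    ultimately show ?thesis by simp
  qed
  show "\<exists>!g. g \<in> F\<^sub>\<alpha> \<rightarrow>\<^sub>E F\<^sub>\<beta> \<and> (\<forall>x\<in>F. f\<^sub>\<beta> x = g (f\<^sub>\<alpha> x))"
  proof (rule ex1I[of _ h])
    have "h u \<in> F\<^sub>\<beta>" if "u \<in> F\<^sub>\<alpha>" for u using that h img by (metis imageE imageI)
    then have "h \<in> F\<^sub>\<alpha> \<rightarrow>\<^sub>E F\<^sub>\<beta>" by (auto simp: h_def)
    with h show "h \<in> F\<^sub>\<alpha> \<rightarrow>\<^sub>E F\<^sub>\<beta> \<and> (\<forall>x\<in>F. f\<^sub>\<beta> x = h (f\<^sub>\<alpha> x))" by blast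
    fix g
    assume g: "g \<in> F\<^sub>\<alpha> \<rightarrow>\<^sub>E F\<^sub>\<beta> \<and> (\<forall>x\<in>F. f\<^sub>\<beta> x = g (f\<^sub>\<alpha> x))"
    show "g = h"
    proof (rule extensionalityI)
      show "g \<in> extensional F\<^sub>\<alpha>" using g by (auto simp: PiE_def)
      show "h \<in> extensional F\<^sub>\<alpha>" by (simp add: h_def)
      \<comment> \<open>Both maps are determined by \<open>f\<^sub>\<beta>\<close> on the image of
        \<open>f\<^sub>\<alpha>\<close>, which is all of \<open>F\<^sub>\<alpha>\<close>.\<close>
      show "g u = h u" if "u \<in> F\<^sub>\<alpha>" for u using that g h img by (metis imageE)
    qed
  qed
  fix g
  assume "g \<in> F\<^sub>\<alpha> \<rightarrow> F\<^sub>\<beta> \<and> (\<forall>x\<in>F. f\<^sub>\<beta> x = g (f\<^sub>\<alpha> x))"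
  then show "contraction (\<beta> / \<alpha>) F\<^sub>\<alpha> \<delta>\<^sub>\<alpha> \<Delta>\<^sub>\<alpha> F\<^sub>\<beta> \<delta>\<^sub>\<beta> \<Delta>\<^sub>\<beta> g"
    by (intro contraction_quotient[OF assms(5-10)]) blast
qed

end
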